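(* Let $X$ be an infinite countable set and let $c=c(\alpha,\beta)$ be a special word on $\{\alpha^{\pm1},\beta^{\pm1}\}$ with $c\notin\langle\beta\rangle$. Then there exists a transitive, faithful and amenable action of the group $\langle \alpha,\beta\rangle *_{\langle c\rangle}\langle\alpha',\beta'\rangle$ on $X$.
   Context: A reduced word $c=g_m\cdots g_1$ on $\{\alpha^{\pm1},\beta^{\pm1}\}$ is weakly cyclically reduced if $g_m\ne g_1^{-1}$. Let $S(\alpha)$ and $S(\beta)$ be the sums of the exponents of $\alpha$ and of $\beta$ in $c$. A weakly cyclically reduced word $c$ is special if either (1) $S(\alpha)=S(\beta)=0$, or (2) $S(\alpha)$ divides $S(\beta)$. Here $\langle\alpha,\beta\rangle$ and $\langle\alpha',\beta'\rangle$ are free groups of rank $2$ on the displayed generators, and $\langle \alpha,\beta\rangle *_{\langle c\rangle}\langle\alpha',\beta'\rangle$ is the amalgamated free product identifying $c(\alpha,\beta)$ with $c(\alpha',\beta')$, i.e. the group $\langle \alpha,\beta,\alpha',\beta'\mid c(\alpha,\beta)=c(\alpha',\beta')\rangle$. An action of a group $G$ on a set $X$ is amenable if there is a $G$-invariant mean on $X$, i.e. a map $\mu:\mathcal P(X)\to[0,1]$ with $\mu(X)=1$, $\mu(A\cup B)=\mu(A)+\mu(B)$ for all disjoint $A,B\subseteq X$, and $\mu(gA)=\mu(A)$ for all $g\in G$, $A\subseteq X$. *)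

theory Defs
  imports Complex_Main "HOL-Algebra.Group_Action" "HOL-Algebra.Generated_Groups" "HOL-Library.Countable_Set"
begin

section \<open>Free groups\<close>

text \<open>A letter \<open>(x, True)\<close> stands for the generator \<open>x\<close>, and \<open>(x, False)\<close> for its inverse.
  A list \<open>[g, h, \<dots>]\<close> is the word \<open>g h \<dots>\<close>, read from left to right.\<close>

type_synonym 'g letter = "'g \<times> bool"
type_synonym 'g word = "'g letter list"

definition inv_letter :: "'g letter \<Rightarrow> 'g letter" where
  "inv_letter a = (fst a, \<not> snd a)"

definition reduced :: "'g word \<Rightarrow> bool" where
  "reduced = successively (\<lambda>a b. b \<noteq> inv_letter a)"

fun cancel_cons :: "'g letter \<Rightarrow> 'g word \<Rightarrow> 'g word" where
  "cancel_cons a [] = [a]"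
| "cancel_cons a (b # w) = (if b = inv_letter a then w else a # b # w)"

definition reduce :: "'g word \<Rightarrow> 'g word" where
  "reduce w = foldr cancel_cons w []"

text \<open>Elements of the free group on the type \<open>'g\<close> are represented by their unique reduced words.\<close>

definition free_group :: "'g word monoid" where
  "free_group = \<lparr>carrier = {w. reduced w}, monoid.mult = (\<lambda>u v. reduce (u @ v)), one = []\<rparr>"

lemma inv_letter_inv_letter [simp]: "inv_letter (inv_letter a) = a"
  by (simp add: inv_letter_def)

lemma inv_letter_neq [simp]: "inv_letter a \<noteq> a" "a \<noteq> inv_letter a"
  by (auto simp: inv_letter_def prod_eq_iff)

lemma reduced_Nil [simp]: "reduced []"
  by (simp add: reduced_def)

lemma reduced_Cons: "reduced (a # w) \<longleftrightarrow> (w = [] \<or> hd w \<noteq> inv_letter a) \<and> reduced w"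
  by (auto simp: reduced_def successively_Cons)

lemma reduced_cancel_cons: "reduced w \<Longrightarrow> reduced (cancel_cons a w)"
  by (cases w) (auto simp: reduced_Cons)

lemma cancel_cons_inv: "reduced w \<Longrightarrow> cancel_cons a (cancel_cons (inv_letter a) w) = w"
proof (cases w)
  case (Cons b v)
  then show "reduced w \<Longrightarrow> ?thesis"
    by (cases v) (auto simp: reduced_Cons)
qed simp

lemma reduce_Nil [simp]: "reduce [] = []"
  by (simp add: reduce_def)

lemma reduce_Cons: "reduce (a # w) = cancel_cons a (reduce w)"
  by (simp add: reduce_def)

lemma reduced_reduce: "reduced (reduce w)"
  by (induction w) (auto simp: reduce_Cons reduced_cancel_cons)

lemma reduce_reduced: "reduced w \<Longrightarrow> reduce w = w"
proof (induction w)
  case (Cons a w)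
  then show ?case
    by (cases w) (auto simp: reduce_Cons reduced_Cons)
qed simp

lemma reduce_append_right: "reduce (u @ reduce v) = reduce (u @ v)"
  by (induction u) (auto simp: reduce_Cons reduce_reduced reduced_reduce)

lemma reduce_cancel_cons_append: "reduce (cancel_cons a w @ v) = cancel_cons a (reduce (w @ v))"
proof (cases w)
  case (Cons b w')
  then show ?thesis
    using cancel_cons_inv[of "reduce (w' @ v)" a] by (simp add: reduce_Cons reduced_reduce)
qed (simp add: reduce_Cons)

lemma reduce_append_left: "reduce (reduce u @ v) = reduce (u @ v)"
  by (induction u) (auto simp: reduce_Cons reduce_cancel_cons_append)

lemma reduce_inv_word: "reduce (map inv_letter (rev w) @ w) = []"
proof (induction w)
  case (Cons a w)
  have "reduce (map inv_letter (rev (a # w)) @ a # w)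
      = reduce (map inv_letter (rev w) @ reduce (inv_letter a # a # w))"
    by (simp add: reduce_append_right)
  also have "reduce (inv_letter a # a # w) = reduce w"
    using cancel_cons_inv[of "reduce w" "inv_letter a"] by (simp add: reduce_Cons reduced_reduce)
  finally show ?case
    using Cons.IH by (simp add: reduce_append_right)
qed simp

lemma group_free_group: "group free_group"
proof (rule groupI)
  fix x y z :: "'a word"
  show "x \<otimes>\<^bsub>free_group\<^esub> y \<otimes>\<^bsub>free_group\<^esub> z = x \<otimes>\<^bsub>free_group\<^esub> (y \<otimes>\<^bsub>free_group\<^esub> z)"
    by (simp add: free_group_def reduce_append_left reduce_append_right)
next
  fix x :: "'a word"
  let ?y = "reduce (map inv_letter (rev x))"
  have "?y \<otimes>\<^bsub>free_group\<^esub> x = \<one>\<^bsub>free_group\<^esub>"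
    by (simp add: free_group_def reduce_append_left reduce_inv_word)
  then show "\<exists>y\<in>carrier free_group. y \<otimes>\<^bsub>free_group\<^esub> x = \<one>\<^bsub>free_group\<^esub>"
    by (rule bexI) (simp add: free_group_def reduced_reduce)
qed (auto simp: free_group_def reduced_reduce reduce_reduced)


section \<open>Group presentations\<close>

definition normal_closure :: "('a, 'b) monoid_scheme \<Rightarrow> 'a set \<Rightarrow> 'a set" where
  "normal_closure G R = \<Inter> {N. N \<lhd> G \<and> R \<subseteq> N}"

lemma (in group) normal_normal_closure:
  assumes "R \<subseteq> carrier G"
  shows "normal_closure G R \<lhd> G"
proof -
  have "carrier G \<lhd> G"
    by (simp add: normal_inv_iff subgroup_self)
  then have "subgroup (normal_closure G R) G"
    unfolding normal_closure_def using assms normal_imp_subgroup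
    by (intro subgroups_Inter) auto
  then show ?thesis
    by (auto simp: normal_inv_iff normal_closure_def)
qed

text \<open>The group with all elements of \<open>'g\<close> as generators, subject to the relations \<open>u = v\<close>
  for \<open>(u, v) \<in> R\<close>.\<close>

definition presented_group :: "('g word \<times> 'g word) set \<Rightarrow> 'g word set monoid" where
  "presented_group R = free_group Mod
     normal_closure free_group {u \<otimes>\<^bsub>free_group\<^esub> inv\<^bsub>free_group\<^esub> v | u v. (u, v) \<in> R}"


section \<open>The amalgamated free product of two free groups of rank two\<close>

datatype gen = Alpha | Beta

text \<open>\<open>Inl Alpha\<close>, \<open>Inl Beta\<close> are the generators \<open>\<alpha>\<close>, \<open>\<beta>\<close>, and \<open>Inr Alpha\<close>, \<open>Inr Beta\<close> are the
  generators \<open>\<alpha>'\<close>, \<open>\<beta>'\<close>.\<close>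

definition amalgam :: "gen word \<Rightarrow> (gen + gen) word set monoid" where
  "amalgam c = presented_group {(map (map_prod Inl id) c, map (map_prod Inr id) c)}"

lemma group_amalgam:
  assumes "reduced c"
  shows "group (amalgam c)"
proof -
  interpret F: group "free_group :: (gen + gen) word monoid"
    by (rule group_free_group)
  have "reduced (map (map_prod f id) c)" if "inj f" for f :: "gen \<Rightarrow> gen + gen"
    using assms
  proof (induction c)
    case (Cons a c)
    then show ?case
      using that by (cases c) (auto simp: reduced_Cons inv_letter_def prod_eq_iff inj_eq)
  qed simp
  then have "map (map_prod Inl id) c \<in> carrier (free_group :: (gen + gen) word monoid)"
    "map (map_prod Inr id) c \<in> carrier (free_group :: (gen + gen) word monoid)"
    by (simp_all add: free_group_def)
  then show ?thesis
    unfolding amalgam_def presented_group_def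
    by (intro normal.factorgroup_is_group F.normal_normal_closure) auto
qed


section \<open>Special words\<close>

definition exponent_sum :: "'g \<Rightarrow> 'g word \<Rightarrow> int" where
  "exponent_sum x w = (\<Sum>(y, e)\<leftarrow>w. if y = x then (if e then 1 else -1) else 0)"

definition weakly_cyclically_reduced :: "'g word \<Rightarrow> bool" where
  "weakly_cyclically_reduced w \<longleftrightarrow> reduced w \<and> (w \<noteq> [] \<longrightarrow> hd w \<noteq> inv_letter (last w))"

definition special :: "gen word \<Rightarrow> bool" where
  "special c \<longleftrightarrow> weakly_cyclically_reduced c \<and>
     (exponent_sum Alpha c = 0 \<and> exponent_sum Beta c = 0 \<or>
      exponent_sum Alpha c dvd exponent_sum Beta c)"


section \<open>Amenable actions\<close>

definition invariant_mean ::
  "('g, 'm) monoid_scheme \<Rightarrow> 'x set \<Rightarrow> ('g \<Rightarrow> 'x \<Rightarrow> 'x) \<Rightarrow> ('x set \<Rightarrow> real) \<Rightarrow> bool" where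
  "invariant_mean G X \<phi> \<mu> \<longleftrightarrow>
     \<mu> \<in> Pow X \<rightarrow> {0..1} \<and> \<mu> X = 1 \<and>
     (\<forall>A B. A \<subseteq> X \<and> B \<subseteq> X \<and> A \<inter> B = {} \<longrightarrow> \<mu> (A \<union> B) = \<mu> A + \<mu> B) \<and>
     (\<forall>g\<in>carrier G. \<forall>A. A \<subseteq> X \<longrightarrow> \<mu> (\<phi> g ` A) = \<mu> A)"

locale amenable_action = group_action +
  assumes amenable: "\<exists>\<mu>. invariant_mean G E \<phi> \<mu>"

end

theory Submission
  imports Defs "HOL-Algebra.SndIsomorphismGrp" "HOL-Algebra.Left_Coset"
    "HOL-Analysis.Function_Topology" "HOL-Combinatorics.Transposition"
begin

text \<open>Write \<open>G\<close> for the amalgam. In a special word \<open>c\<close> we have \<open>S(\<beta>) = k S(\<alpha>)\<close> for some integer \<open>k\<close>, so the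
homomorphism from \<open>G\<close> to the integers with \<open>\<alpha>, \<alpha>' \<mapsto> - k\<close> and \<open>\<beta>, \<beta>' \<mapsto> 1\<close> kills \<open>c\<close>. Let \<open>G\<close> act on the
disjoint union of the coset space \<open>G / \<langle>c\<rangle>\<close> and the line \<open>\<int>\<close>, on the latter by translations through
this homomorphism. The element \<open>c\<close> fixes the coset \<open>\<langle>c\<rangle>\<close> and every integer, so it commutes with the
transposition that exchanges \<open>\<langle>c\<rangle>\<close> with \<open>0\<close>. Conjugate the action of \<open>\<alpha>\<close> and \<open>\<beta>\<close> by this transposition
and leave \<open>\<alpha>'\<close> and \<open>\<beta>'\<close> as they are: \<open>c(\<alpha>, \<beta>)\<close> still acts as \<open>c(\<alpha>', \<beta>')\<close>, so the result is again an
action of \<open>G\<close>.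

The new action is transitive (\<open>glued_act_transitive\<close>): the orbit of \<open>0\<close> contains the line and the coset
\<open>\<langle>c\<rangle>\<close>, so it is invariant under the transposition and therefore under the old action as well. It is
amenable (\<open>glued_act_Folner\<close>, \<open>Folner_mean\<close>): a generator acts on the line as a translation with at most
two exceptions, so that the intervals \<open>{0..n}\<close> form a Folner sequence.

It is faithful (\<open>glued_act_faithful\<close>) by means of the retraction \<open>r\<close> of \<open>G\<close> onto the free group
\<open>\<langle>\<alpha>, \<beta>\<rangle>\<close> that folds the two factors; it is injective on \<open>\<langle>c\<rangle>\<close>. Let \<open>w \<noteq> 1\<close> in \<open>G\<close>. If
\<open>r w = 1\<close>, then \<open>w\<close> is in no conjugate of \<open>\<langle>c\<rangle>\<close>, hence moves every coset. If \<open>u = r w \<noteq> 1\<close>, then \<open>w\<close>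
moves the coset of each \<open>g\<close> in \<open>\<langle>\<alpha>, \<beta>\<rangle>\<close> for which \<open>g\<^sup>-\<^sup>1 u g\<close> is reduced as it stands, because that
word begins with the inverse of its last letter while all powers of \<open>c\<close> are weakly cyclically reduced.
In both cases \<open>g = x \<beta>\<^sup>m\<close> qualifies for a suitable letter \<open>x\<close> and all \<open>m\<close>, and these elements
represent infinitely many cosets because \<open>c \<notin> \<langle>\<beta>\<rangle>\<close>. Only finitely many cosets are taken to \<open>\<langle>c\<rangle>\<close> on
the path described by \<open>w\<close>; along the other paths the old and the new action agree.\<close>


section \<open>Actions of presented groups\<close>

interpretation free_group: group free_group
  by (rule group_free_group)

lemma in_free_group: "w \<in> carrier free_group \<longleftrightarrow> reduced w"
  by (simp add: free_group_def)

text \<open>An action of the free group is given by one map for each letter. Asking only that the maps of a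
letter and of its inverse letter cancel on \<open>Y\<close> leaves their values outside \<open>Y\<close> free; in particular
they need not be extensional, as the members of \<^term>\<open>BijGroup Y\<close> must be. The word \<open>w\<close> acts as
\<^term>\<open>foldr \<rho> w\<close>, so that its last letter acts first.\<close>

locale letter_action =
  fixes Y :: "'y set" and \<rho> :: "'g letter \<Rightarrow> 'y \<Rightarrow> 'y"
  assumes letter_closed: "y \<in> Y \<Longrightarrow> \<rho> a y \<in> Y"
    and letter_cancel: "y \<in> Y \<Longrightarrow> \<rho> (inv_letter a) (\<rho> a y) = y"
begin

lemma foldr_closed: "y \<in> Y \<Longrightarrow> foldr \<rho> w y \<in> Y"
  by (induction w) (auto simp: letter_closed)

lemma foldr_cancel_cons: "y \<in> Y \<Longrightarrow> foldr \<rho> (cancel_cons a w) y = \<rho> a (foldr \<rho> w y)"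
  using letter_cancel[of _ "inv_letter a"] by (cases w) (auto simp: foldr_closed)

lemma foldr_reduce: "y \<in> Y \<Longrightarrow> foldr \<rho> (reduce w) y = foldr \<rho> w y"
  by (induction w) (auto simp: reduce_Cons foldr_cancel_cons)

lemma foldr_inv_word:
  "y \<in> Y \<Longrightarrow> foldr \<rho> (map inv_letter (rev w)) (foldr \<rho> w y) = y"
  by (metis foldr_append foldr_reduce reduce_inv_word foldr.simps(1) id_apply comp_apply)

lemma foldr_inv_word': "y \<in> Y \<Longrightarrow> foldr \<rho> w (foldr \<rho> (map inv_letter (rev w)) y) = y"
  using foldr_inv_word[of y "map inv_letter (rev w)"]
  by (simp add: rev_map comp_def)

lemma foldr_bij: "bij_betw (foldr \<rho> w) Y Y"
  by (rule bij_betw_byWitness[where f' = "foldr \<rho> (map inv_letter (rev w))"])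
    (auto simp: foldr_closed foldr_inv_word foldr_inv_word')

definition word_perm :: "'g word \<Rightarrow> 'y \<Rightarrow> 'y" where
  "word_perm w = restrict (foldr \<rho> w) Y"

lemma word_perm_hom: "group_hom free_group (BijGroup Y) word_perm"
proof -
  have Bij: "word_perm w \<in> Bij Y" for w
    using foldr_bij[of w] by (simp add: Bij_def word_perm_def bij_betw_restrict_eq)
  have "word_perm (reduce (u @ v)) = compose Y (word_perm u) (word_perm v)" for u v
    by (rule ext) (simp add: word_perm_def compose_def foldr_reduce foldr_closed)
  then have "word_perm \<in> hom free_group (BijGroup Y)"
    using Bij by (intro homI) (simp_all add: BijGroup_def free_group_def)
  then show ?thesis
    by (simp add: group_hom_def group_hom_axioms_def group_free_group group_BijGroup)
qed

text \<open>The words that act trivially form the kernel of a homomorphism; this is a normal subgroup, so it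
contains the normal closure of the relators as soon as it contains the relators.\<close>

lemma normal_closure_acts_trivially:
  assumes "\<And>u v. (u, v) \<in> R \<Longrightarrow> reduced u \<and> reduced v"
    and "\<And>u v y. (u, v) \<in> R \<Longrightarrow> y \<in> Y \<Longrightarrow> foldr \<rho> u y = foldr \<rho> v y"
  shows "normal_closure free_group {u \<otimes>\<^bsub>free_group\<^esub> inv\<^bsub>free_group\<^esub> v | u v. (u, v) \<in> R}
    \<subseteq> kernel free_group (BijGroup Y) word_perm"
proof -
  interpret h: group_hom free_group "BijGroup Y" word_perm
    by (rule word_perm_hom)
  have "u \<otimes>\<^bsub>free_group\<^esub> inv\<^bsub>free_group\<^esub> v \<in> kernel free_group (BijGroup Y) word_perm"
    if uv: "(u, v) \<in> R" for u v
  proof -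
    have c: "u \<in> carrier free_group" "v \<in> carrier free_group"
      using assms(1)[OF uv] by (auto simp: free_group_def)
    have "word_perm u = word_perm v"
      using assms(2)[OF uv] by (auto simp: word_perm_def)
    then show ?thesis
      using c by (simp add: kernel_def)
  qed
  then show ?thesis
    unfolding normal_closure_def using h.normal_kernel by (intro Inter_lower) auto
qed

end

text \<open>Everything about the action of the presented group can be tested on words: reaching every point from
one base point gives transitivity, and moving a point with every reduced word outside \<open>N\<close> gives
faithfulness, since \<open>N\<close> is the kernel of the projection to the presented group.\<close>

lemma presented_group_action:
  fixes R :: "('g word \<times> 'g word) set"
  defines "N \<equiv> normal_closure free_group
    {u \<otimes>\<^bsub>free_group\<^esub> inv\<^bsub>free_group\<^esub> v | u v. (u, v) \<in> R}"
  assumes act: "letter_action Y \<rho>"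
    and red: "\<And>u v. (u, v) \<in> R \<Longrightarrow> reduced u \<and> reduced v"
    and rel: "\<And>u v y. (u, v) \<in> R \<Longrightarrow> y \<in> Y \<Longrightarrow> foldr \<rho> u y = foldr \<rho> v y"
    and "y\<^sub>0 \<in> Y" and reach: "\<And>y. y \<in> Y \<Longrightarrow> \<exists>w. foldr \<rho> w y\<^sub>0 = y"
    and moves: "\<And>w. reduced w \<Longrightarrow> w \<notin> N \<Longrightarrow> \<exists>y\<in>Y. foldr \<rho> w y \<noteq> y"
  obtains \<phi> where "transitive_action (presented_group R) Y \<phi>"
    "faithful_action (presented_group R) Y \<phi>"
    "\<And>g. g \<in> carrier (presented_group R) \<Longrightarrow> \<exists>w. \<forall>y\<in>Y. \<phi> g y = foldr \<rho> w y"
proof -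
  interpret letter_action Y \<rho> by (rule act)
  interpret h: group_hom free_group "BijGroup Y" word_perm
    by (rule word_perm_hom)
  have N: "N \<lhd> free_group"
    unfolding N_def using red
    by (intro free_group.normal_normal_closure) (force simp: in_free_group[symmetric])
  have P: "presented_group R = free_group Mod N"
    by (simp add: presented_group_def N_def)
  have G: "group (presented_group R)"
    unfolding P by (rule normal.factorgroup_is_group[OF N])
  obtain \<phi> where hom: "\<phi> \<in> hom (free_group Mod N) (BijGroup Y)"
    and \<phi>: "\<And>w. w \<in> carrier free_group \<Longrightarrow> \<phi> (N #>\<^bsub>free_group\<^esub> w) = word_perm w"
    using h.FactGroup_universal_kernel[OF N] normal_closure_acts_trivially[OF red rel]
    unfolding N_def by blast
  have ghom: "group_hom (presented_group R) (BijGroup Y) \<phi>"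
    using hom G by (simp add: P group_hom_def group_hom_axioms_def group_BijGroup)
  then interpret G: group_hom "presented_group R" "BijGroup Y" \<phi> .
  have act': "group_action (presented_group R) Y \<phi>"
    using ghom by (simp add: group_action_def)
  have elem: "\<exists>w. reduced w \<and> g = N #>\<^bsub>free_group\<^esub> w" if "g \<in> carrier (presented_group R)" for g
    using that by (auto simp: P FactGroup_def RCOSETS_def free_group_def)
  have mem: "N #>\<^bsub>free_group\<^esub> w \<in> carrier (presented_group R)" if "reduced w" for w
    using that by (auto simp: P FactGroup_def RCOSETS_def free_group_def)
  have "\<exists>w. \<forall>y\<in>Y. \<phi> g y = foldr \<rho> w y" if "g \<in> carrier (presented_group R)" for g
    using elem[OF that] \<phi> by (auto simp: free_group_def word_perm_def)
  moreover have "transitive_action (presented_group R) Y \<phi>"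
  proof (intro transitive_action.intro transitive_action_axioms.intro act')
    fix x y assume "x \<in> Y" "y \<in> Y"
    then obtain u v where u: "foldr \<rho> u y\<^sub>0 = x" and v: "foldr \<rho> v y\<^sub>0 = y"
      using reach by meson
    let ?w = "reduce (v @ map inv_letter (rev u))"
    have "foldr \<rho> ?w x = y"
      using \<open>x \<in> Y\<close> foldr_inv_word[OF \<open>y\<^sub>0 \<in> Y\<close>, of u] by (simp add: foldr_reduce u v)
    then have "\<phi> (N #>\<^bsub>free_group\<^esub> ?w) x = y"
      using \<phi>[of ?w] \<open>x \<in> Y\<close> by (simp add: free_group_def word_perm_def reduced_reduce)
    then show "\<exists>g\<in>carrier (presented_group R). \<phi> g x = y"
      using mem[OF reduced_reduce] by blast
  qed
  moreover have "faithful_action (presented_group R) Y \<phi>"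
  proof (intro faithful_action.intro faithful_action_axioms.intro act')
    have "g = \<one>\<^bsub>presented_group R\<^esub>"
      if g: "g \<in> carrier (presented_group R)" "\<phi> g = \<one>\<^bsub>BijGroup Y\<^esub>" for g
    proof -
      obtain w where w: "reduced w" "g = N #>\<^bsub>free_group\<^esub> w"
        using elem g by blast
      have "foldr \<rho> w y = y" if "y \<in> Y" for y
      proof -
        have "word_perm w y = (\<lambda>y\<in>Y. y) y"
          using \<phi>[of w] w g(2) by (simp add: free_group_def BijGroup_def)
        then show ?thesis using that by (simp add: word_perm_def)
      qed
      then have "w \<in> N"
        using moves w by blast
      then have "g = N"
        using w(2) free_group.coset_join2 normal_imp_subgroup[OF N] w(1)
        by (auto simp: free_group_def)
      then show ?thesis
        by (simp add: P)
    qed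
    then show "inj_on \<phi> (carrier (presented_group R))"
      by (subst G.inj_on_one_iff) auto
  qed
  ultimately show thesis
    using that by blast
qed


section \<open>Invariant means from Folner sequences\<close>

text \<open>The mean of a Folner sequence is a cluster point of the sequence of counting measures. A cluster point
inherits every closed condition that holds eventually, and this lemma is the form in which the
properties of the counting measures are passed on to it.\<close>

lemma cluster_point_closed:
  assumes "closed C" "eventually (\<lambda>x. x \<in> C) F" "inf (nhds p) F \<noteq> bot"
  shows "p \<in> C"
proof (rule ccontr)
  assume "p \<notin> C"
  then have "eventually (\<lambda>x. x \<in> - C) (nhds p)"
    using assms(1) by (intro eventually_nhds_in_open) auto
  then have "eventually (\<lambda>x. False) (inf (nhds p) F)"
    using assms(2) unfolding eventually_inf by fastforce
  then show False
    using assms(3) by (simp add: trivial_limit_def)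
qed

text \<open>By Tychonoff's theorem the normalised counting measures of the sets \<open>F n\<close> have a cluster point \<open>\<mu>\<close> in
the compact cube of all maps from subsets to \<open>{0..1}\<close>. A bijection that moves only a vanishing
proportion of \<open>F n\<close> out of \<open>F n\<close> can decrease the counting measure of a set only by a vanishing amount,
hence \<open>\<mu> A \<le> \<mu> (f ` A)\<close>; applied to the complement of \<open>A\<close> this gives the opposite inequality. The
cluster point is chosen before \<open>f\<close>, so a single \<open>\<mu>\<close> serves all generators of a group at once.\<close>

lemma Folner_mean:
  fixes F :: "nat \<Rightarrow> 'x set"
  assumes F: "\<And>n. finite (F n)" "\<And>n. F n \<noteq> {}" "\<And>n. F n \<subseteq> X"
  obtains \<mu> :: "'x set \<Rightarrow> real" where "\<And>A. 0 \<le> \<mu> A" "\<And>A. \<mu> A \<le> 1" "\<mu> X = 1"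
    "\<And>A B. A \<inter> B = {} \<Longrightarrow> \<mu> (A \<union> B) = \<mu> A + \<mu> B"
    "\<And>f A. bij_betw f X X \<Longrightarrow> (\<lambda>n. card (f ` F n - F n) / card (F n)) \<longlonglongrightarrow> 0
        \<Longrightarrow> A \<subseteq> X \<Longrightarrow> \<mu> (f ` A) = \<mu> A"
proof -
  define m where "m n A = real (card (A \<inter> F n)) / real (card (F n))" for n A
  define \<F> where "\<F> = filtermap m sequentially"
  have pos: "card (F n) > 0" for n
    using F by (simp add: card_gt_0_iff)
  have m01: "0 \<le> m n A" "m n A \<le> 1" for n A
    using pos[of n] card_mono[of "F n" "A \<inter> F n"] F(1)[of n]
    by (auto simp: m_def divide_le_eq_1)
  have "compactin (product_topology (\<lambda>_. euclideanreal) UNIV)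
      (PiE (UNIV :: 'x set set) (\<lambda>_. {0..1}))"
    by (subst compactin_PiE) auto
  then have "compact (PiE (UNIV :: 'x set set) (\<lambda>_. {0..1::real}))"
    by (simp add: euclidean_product_topology)
  moreover have "eventually (\<lambda>x. x \<in> PiE UNIV (\<lambda>_. {0..1})) \<F>"
    by (simp add: \<F>_def eventually_filtermap PiE_iff m01)
  moreover have "\<F> \<noteq> bot"
    by (simp add: \<F>_def filtermap_bot_iff)
  ultimately obtain \<mu> where \<mu>: "\<mu> \<in> PiE UNIV (\<lambda>_. {0..1})" "inf (nhds \<mu>) \<F> \<noteq> bot"
    unfolding compact_filter by blast
  have limit: "\<mu> \<in> C" if "closed C" "eventually (\<lambda>n. m n \<in> C) sequentially" for C
    by (rule cluster_point_closed[OF that(1) _ \<mu>(2)]) (simp add: \<F>_def eventually_filtermap that(2))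
  have cont: "continuous_on UNIV (\<lambda>\<nu>::'x set \<Rightarrow> real. \<nu> A)" for A
    by (rule continuous_on_product_coordinates)
  have range: "0 \<le> \<mu> A" "\<mu> A \<le> 1" for A
    using \<mu>(1) by auto
  have "\<mu> \<in> {\<nu>. \<nu> X = 1}"
  proof (rule limit)
    show "closed {\<nu>. \<nu> X = (1 :: real)}"
      by (intro closed_Collect_eq continuous_on_const cont)
    show "eventually (\<lambda>n. m n \<in> {\<nu>. \<nu> X = 1}) sequentially"
      using pos F by (simp add: m_def Int_absorb1)
  qed
  then have whole: "\<mu> X = 1" by simp
  have add: "\<mu> (A \<union> B) = \<mu> A + \<mu> B" if "A \<inter> B = {}" for A B
  proof -
    have "card ((A \<union> B) \<inter> F n) = card (A \<inter> F n) + card (B \<inter> F n)" for n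
      using that F(1) by (subst card_Un_disjoint[symmetric]) (auto simp: Int_Un_distrib2)
    then have "\<mu> \<in> {\<nu>. \<nu> (A \<union> B) = \<nu> A + \<nu> B}"
      by (intro limit closed_Collect_eq continuous_on_add cont)
        (simp add: m_def add_divide_distrib)
    then show ?thesis by simp
  qed
  have le: "\<mu> A \<le> \<mu> (f ` A)"
    if f: "bij_betw f X X" and lim: "(\<lambda>n. card (f ` F n - F n) / card (F n)) \<longlonglongrightarrow> 0"
      and A: "A \<subseteq> X" for f A
  proof (rule field_le_epsilon)
    fix \<epsilon> :: real assume "\<epsilon> > 0"
    have step: "m n A \<le> m n (f ` A) + card (f ` F n - F n) / card (F n)" for n
    proof -
      have "inj_on f (A \<inter> F n)"
        using f A by (meson bij_betw_def inj_on_subset le_infI1)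
      then have "card (A \<inter> F n) = card (f ` (A \<inter> F n))"
        by (simp add: card_image)
      also have "\<dots> \<le> card ((f ` A \<inter> F n) \<union> (f ` F n - F n))"
        using F(1) by (intro card_mono) auto
      also have "\<dots> \<le> card (f ` A \<inter> F n) + card (f ` F n - F n)"
        by (rule card_Un_le)
      finally have "real (card (A \<inter> F n))
          \<le> real (card (f ` A \<inter> F n)) + real (card (f ` F n - F n))"
        by linarith
      then show ?thesis
        unfolding m_def add_divide_distrib[symmetric] by (rule divide_right_mono) simp
    qed
    have "eventually (\<lambda>n. card (f ` F n - F n) / card (F n) < \<epsilon>) sequentially"
      using lim \<open>\<epsilon> > 0\<close> by (rule order_tendstoD(2))
    then have "eventually (\<lambda>n. m n \<in> {\<nu>. \<nu> A \<le> \<nu> (f ` A) + \<epsilon>}) sequentially"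
    proof eventually_elim
      case (elim n)
      then show ?case using step[of n] by simp
    qed
    then have "\<mu> \<in> {\<nu>. \<nu> A \<le> \<nu> (f ` A) + \<epsilon>}"
      by (intro limit closed_Collect_le continuous_on_add continuous_on_const cont)
    then show "\<mu> A \<le> \<mu> (f ` A) + \<epsilon>" by simp
  qed
  have "\<mu> (f ` A) = \<mu> A"
    if f: "bij_betw f X X" and lim: "(\<lambda>n. card (f ` F n - F n) / card (F n)) \<longlonglongrightarrow> 0"
      and A: "A \<subseteq> X" for f A
  proof -
    have compl: "\<mu> (X - B) = 1 - \<mu> B" if "B \<subseteq> X" for B
      using add[of B "X - B"] whole that by (simp add: Un_absorb1)
    have "f ` (X - A) = f ` X - f ` A"
      using f A by (intro inj_on_image_set_diff[where C = X]) (auto simp: bij_betw_def)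
    then have "f ` (X - A) = X - f ` A"
      using f by (simp add: bij_betw_def)
    moreover have "f ` A \<subseteq> X"
      using f A unfolding bij_betw_def by blast
    ultimately have "1 - \<mu> A \<le> 1 - \<mu> (f ` A)"
      using le[OF f lim, of "X - A"] compl A by simp
    with le[OF f lim A] show ?thesis by simp
  qed
  then show thesis
    by (intro that[of \<mu>] range whole add) assumption+
qed


lemma (in letter_action) transport:
  assumes e: "bij_betw e Y X"
  defines "\<rho>' \<equiv> \<lambda>a x. e (\<rho> a (inv_into Y e x))"
  shows "letter_action X \<rho>'"
    and "y \<in> Y \<Longrightarrow> foldr \<rho>' w (e y) = e (foldr \<rho> w y)"
proof -
  have inv: "inv_into Y e (e y) = y" if "y \<in> Y" for y
    using e that by (simp add: bij_betw_inv_into_left)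
  have X: "x \<in> X \<longleftrightarrow> (\<exists>y\<in>Y. x = e y)" for x
    using e by (auto simp: bij_betw_def)
  show "letter_action X \<rho>'"
    by unfold_locales (auto simp: X \<rho>'_def inv letter_closed letter_cancel)
  show "foldr \<rho>' w (e y) = e (foldr \<rho> w y)" if "y \<in> Y"
    by (induction w) (simp_all add: \<rho>'_def inv foldr_closed that)
qed

text \<open>A transitive, faithful and amenable action on \<open>X\<close> can be built on any set \<open>Y\<close> equipotent with \<open>X\<close> from
maps for the letters. The Folner condition is imposed letter by letter, as the permutations that
preserve a given mean are closed under composition.\<close>

theorem presented_group_amenable_action:
  fixes R :: "('g word \<times> 'g word) set" and F :: "nat \<Rightarrow> 'y set" and X :: "'x set"
  defines "N \<equiv> normal_closure free_group
    {u \<otimes>\<^bsub>free_group\<^esub> inv\<^bsub>free_group\<^esub> v | u v. (u, v) \<in> R}"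
  assumes e: "bij_betw e Y X" and act: "letter_action Y \<rho>"
    and red: "\<And>u v. (u, v) \<in> R \<Longrightarrow> reduced u \<and> reduced v"
    and rel: "\<And>u v y. (u, v) \<in> R \<Longrightarrow> y \<in> Y \<Longrightarrow> foldr \<rho> u y = foldr \<rho> v y"
    and y\<^sub>0: "y\<^sub>0 \<in> Y" and reach: "\<And>y. y \<in> Y \<Longrightarrow> \<exists>w. foldr \<rho> w y\<^sub>0 = y"
    and moves: "\<And>w. reduced w \<Longrightarrow> w \<notin> N \<Longrightarrow> \<exists>y\<in>Y. foldr \<rho> w y \<noteq> y"
    and F: "\<And>n. finite (F n)" "\<And>n. F n \<noteq> {}" "\<And>n. F n \<subseteq> Y"
    and Folner: "\<And>a. (\<lambda>n. card (\<rho> a ` F n - F n) / card (F n)) \<longlonglongrightarrow> 0"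
  shows "\<exists>\<phi>. transitive_action (presented_group R) X \<phi> \<and>
    faithful_action (presented_group R) X \<phi> \<and> amenable_action (presented_group R) X \<phi>"
proof -
  define \<rho>' where "\<rho>' a x = e (\<rho> a (inv_into Y e x))" for a x
  interpret Y: letter_action Y \<rho> by (rule act)
  interpret X: letter_action X \<rho>'
    using Y.transport(1)[OF e] by (simp add: \<rho>'_def[abs_def])
  have foldr': "foldr \<rho>' w (e y) = e (foldr \<rho> w y)" if "y \<in> Y" for w y
    using Y.transport(2)[OF e that] by (simp add: \<rho>'_def[abs_def])
  have letter': "\<rho>' a (e y) = e (\<rho> a y)" if "y \<in> Y" for a y
    using foldr'[OF that, of "[a]"] by simp
  have X: "x \<in> X \<longleftrightarrow> (\<exists>y\<in>Y. x = e y)" for x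
    using e by (auto simp: bij_betw_def)
  have e_inj: "inj_on e Y"
    using e by (simp add: bij_betw_def)
  have rel': "foldr \<rho>' u x = foldr \<rho>' v x" if "(u, v) \<in> R" "x \<in> X" for u v x
    using that rel by (auto simp: X foldr')
  have reach': "\<exists>w. foldr \<rho>' w (e y\<^sub>0) = x" if "x \<in> X" for x
    using that reach y\<^sub>0 by (metis X foldr')
  have moves': "\<exists>x\<in>X. foldr \<rho>' w x \<noteq> x" if w: "reduced w" "w \<notin> N" for w
  proof -
    obtain y where "y \<in> Y" "foldr \<rho> w y \<noteq> y"
      using moves[OF w] by blast
    then show ?thesis
      using e_inj by (intro bexI[of _ "e y"]) (auto simp: X foldr' inj_on_eq_iff Y.foldr_closed)
  qed
  obtain \<phi> where \<phi>: "transitive_action (presented_group R) X \<phi>"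
      "faithful_action (presented_group R) X \<phi>"
      "\<And>g. g \<in> carrier (presented_group R) \<Longrightarrow> \<exists>w. \<forall>x\<in>X. \<phi> g x = foldr \<rho>' w x"
    using presented_group_action[OF X.letter_action_axioms red rel' _ reach' moves'[unfolded N_def]]
      y\<^sub>0 X by blast

  have F': "finite (e ` F n)" "e ` F n \<noteq> {}" "e ` F n \<subseteq> X" for n
    using F X by blast+
  obtain \<mu> :: "'x set \<Rightarrow> real" where \<mu>: "\<And>A. 0 \<le> \<mu> A" "\<And>A. \<mu> A \<le> 1" "\<mu> X = 1"
    "\<And>A B. A \<inter> B = {} \<Longrightarrow> \<mu> (A \<union> B) = \<mu> A + \<mu> B"
    "\<And>f A. bij_betw f X X \<Longrightarrow> (\<lambda>n. card (f ` e ` F n - e ` F n) / card (e ` F n)) \<longlonglongrightarrow> 0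
        \<Longrightarrow> A \<subseteq> X \<Longrightarrow> \<mu> (f ` A) = \<mu> A"
    using Folner_mean[of "\<lambda>n. e ` F n" X, OF F'] by blast
  have letter_invariant: "\<mu> (\<rho>' a ` A) = \<mu> A" if A: "A \<subseteq> X" for a A
  proof (rule \<mu>(5)[OF _ _ A])
    show "bij_betw (\<rho>' a) X X"
      using X.foldr_bij[of "[a]"] by simp
    have "\<rho>' a ` e ` F n = e ` \<rho> a ` F n" for n
      unfolding image_image using F(3) by (intro image_cong refl letter') blast
    moreover have "e ` B - e ` C = e ` (B - C)" if "B \<subseteq> Y" "C \<subseteq> Y" for B C
      using inj_on_image_set_diff[OF e_inj, of B C] that by auto
    moreover have "\<rho> a ` F n \<subseteq> Y" for n
      using F(3) Y.letter_closed by blast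
    moreover have "card (e ` B) = card B" if "B \<subseteq> Y" for B
      using e_inj that by (meson card_image inj_on_subset)
    ultimately show "(\<lambda>n. card (\<rho>' a ` e ` F n - e ` F n) / card (e ` F n)) \<longlonglongrightarrow> 0"
      using Folner[of a] F(3) by (simp add: le_supI1 Diff_subset[THEN subset_trans])
  qed
  have word_invariant: "\<mu> (foldr \<rho>' w ` A) = \<mu> A" if "A \<subseteq> X" for w A
  proof (induction w)
    case (Cons a w)
    have "foldr \<rho>' (a # w) ` A = \<rho>' a ` (foldr \<rho>' w ` A)"
      by (simp add: image_comp)
    also have "\<mu> \<dots> = \<mu> (foldr \<rho>' w ` A)"
      using that by (intro letter_invariant) (auto simp: X.foldr_closed)
    finally show ?case
      using Cons by simp
  qed simp
  have "invariant_mean (presented_group R) X \<phi> \<mu>"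
    unfolding invariant_mean_def
  proof (intro conjI ballI allI impI)
    fix g A assume g: "g \<in> carrier (presented_group R)" and A: "A \<subseteq> X"
    obtain w where w: "\<forall>x\<in>X. \<phi> g x = foldr \<rho>' w x"
      using \<phi>(3)[OF g] by blast
    have "\<phi> g ` A = foldr \<rho>' w ` A"
      using w A by (intro image_cong) auto
    then show "\<mu> (\<phi> g ` A) = \<mu> A"
      using word_invariant[OF A] by simp
  qed (use \<mu>(1-4) in auto)
  then have "amenable_action (presented_group R) X \<phi>"
    using \<phi>(1) by (auto simp: amenable_action_def amenable_action_axioms_def transitive_action_def)
  then show ?thesis
    using \<phi>(1,2) by blast
qed


section \<open>Cyclically reduced words\<close>

lemma reduced_append:
  "reduced (u @ v) \<longleftrightarrow>
    reduced u \<and> reduced v \<and> (u = [] \<or> v = [] \<or> hd v \<noteq> inv_letter (last u))"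
  by (auto simp: reduced_def successively_append_iff)

lemma reduced_inv_word: "reduced (map inv_letter (rev w)) \<longleftrightarrow> reduced w"
proof -
  have "(inv_letter a \<noteq> b) = (inv_letter b \<noteq> a)" for a b :: "'a letter"
    by auto
  then show ?thesis
    by (simp add: reduced_def successively_map successively_rev eq_commute)
qed

lemma inv_free_group:
  assumes "reduced w"
  shows "inv\<^bsub>free_group\<^esub> w = map inv_letter (rev w)"
  using assms
  by (intro free_group.inv_equality)
    (simp_all add: free_group_def reduced_inv_word reduce_inv_word)

lemma weakly_cyclically_reduced_inv_word:
  assumes "weakly_cyclically_reduced w"
  shows "weakly_cyclically_reduced (map inv_letter (rev w))"
  using assms
  by (auto simp: weakly_cyclically_reduced_def reduced_inv_word hd_map last_map hd_rev last_rev)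

lemma reduced_concat_replicate:
  assumes "weakly_cyclically_reduced c" "c \<noteq> []"
  shows "reduced (concat (replicate n c)) \<and>
    (n > 0 \<longrightarrow> hd (concat (replicate n c)) = hd c \<and> last (concat (replicate n c)) = last c)"
  using assms
  by (induction n) (auto simp: reduced_append last_append weakly_cyclically_reduced_def)

lemma nat_pow_free_group:
  assumes "weakly_cyclically_reduced c"
  shows "c [^]\<^bsub>free_group\<^esub> (n::nat) = concat (replicate n c)"
proof (cases "c = []")
  case True
  then show ?thesis
    by (induction n) (simp_all add: free_group_def)
next
  case False
  have *: "concat (replicate n c) @ c = concat (replicate (Suc n) c)" for n
    by (induction n) auto
  show ?thesis
  proof (induction n)
    case (Suc n)
    have "c [^]\<^bsub>free_group\<^esub> Suc n = reduce (concat (replicate n c) @ c)"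
      using Suc by (simp add: free_group_def)
    also have "\<dots> = concat (replicate (Suc n) c)"
      unfolding * using reduced_concat_replicate[OF assms False] by (blast intro: reduce_reduced)
    finally show ?case .
  qed (simp add: free_group_def)
qed

lemma weakly_cyclically_reduced_concat_replicate:
  assumes "weakly_cyclically_reduced c"
  shows "weakly_cyclically_reduced (concat (replicate n c))"
proof (cases "c = [] \<or> n = 0")
  case True
  then show ?thesis by (auto simp: weakly_cyclically_reduced_def)
next
  case False
  then show ?thesis
    using assms reduced_concat_replicate[OF assms, of n]
    by (auto simp: weakly_cyclically_reduced_def)
qed

text \<open>No cancellation occurs in the powers of a weakly cyclically reduced word: they are repetitions of the
word or of its inverse. This makes the powers of \<open>c\<close> visible as reduced words, and the lemmas
below read off from it what is needed about the cyclic group \<open>\<langle>c\<rangle>\<close>.\<close>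

lemma int_pow_cases:
  fixes k :: int
  assumes "weakly_cyclically_reduced c"
  obtains n where "n = nat \<bar>k\<bar>" "c [^]\<^bsub>free_group\<^esub> k = concat (replicate n c)"
  | n where "n = nat \<bar>k\<bar>" "c [^]\<^bsub>free_group\<^esub> k = map inv_letter (rev (concat (replicate n c)))"
proof (cases "k \<ge> 0")
  case True
  then have "c [^]\<^bsub>free_group\<^esub> k = concat (replicate (nat \<bar>k\<bar>) c)"
    using nat_pow_free_group[OF assms] int_pow_int[of free_group c "nat k"] by simp
  then show ?thesis
    using that(1) by blast
next
  case False
  have "c \<in> carrier free_group"
    using assms by (simp add: in_free_group weakly_cyclically_reduced_def)
  then have "c [^]\<^bsub>free_group\<^esub> k = inv\<^bsub>free_group\<^esub> (concat (replicate (nat \<bar>k\<bar>) c))"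
    using free_group.int_pow_neg_int[of c "nat \<bar>k\<bar>"] False by (simp add: nat_pow_free_group[OF assms])
  moreover have "reduced (concat (replicate (nat \<bar>k\<bar>) c))"
    using weakly_cyclically_reduced_concat_replicate[OF assms]
    by (simp add: weakly_cyclically_reduced_def)
  ultimately show ?thesis
    using that(2) by (simp add: inv_free_group)
qed

lemma weakly_cyclically_reduced_int_pow:
  assumes "weakly_cyclically_reduced c"
  shows "weakly_cyclically_reduced (c [^]\<^bsub>free_group\<^esub> (k::int))"
  using weakly_cyclically_reduced_concat_replicate[OF assms]
  by (cases rule: int_pow_cases[OF assms, of k]) (simp_all add: weakly_cyclically_reduced_inv_word)

lemma generators_int_pow:
  assumes "weakly_cyclically_reduced c" "k \<noteq> 0"
  shows "fst ` set (c [^]\<^bsub>free_group\<^esub> (k::int)) = fst ` set c"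
proof -
  have "fst ` set (map inv_letter (rev w)) = fst ` set w" for w :: "'a word"
    by (auto simp: inv_letter_def image_image)
  moreover have "set (concat (replicate n c)) = set c" if "n = nat \<bar>k\<bar>" for n
    using that assms(2) by (auto simp: set_replicate_conv_if)
  ultimately show ?thesis
    by (cases rule: int_pow_cases[OF assms(1), of k]) simp_all
qed

lemma int_pow_eq_Nil_iff:
  assumes "weakly_cyclically_reduced c" "c \<noteq> []"
  shows "c [^]\<^bsub>free_group\<^esub> (k::int) = [] \<longleftrightarrow> k = 0"
proof
  assume *: "c [^]\<^bsub>free_group\<^esub> k = []"
  show "k = 0"
  proof (rule ccontr)
    assume "k \<noteq> 0"
    with generators_int_pow[OF assms(1)] * have "set c = {}"
      by fastforce
    with assms(2) show False by simp
  qed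
qed (simp add: free_group_def)

lemma in_generate_singleton:
  assumes "reduced w" "\<And>a. a \<in> set w \<Longrightarrow> fst a = x"
  shows "w \<in> generate free_group {[(x, True)]}"
  using assms
proof (induction w)
  case Nil
  then show ?case
    using generate.one[of free_group] by (simp add: free_group_def)
next
  case (Cons a w)
  have "[a] \<in> generate free_group {[(x, True)]}"
  proof (cases "snd a")
    case True
    then have "[a] = [(x, True)]"
      using Cons.prems(2)[of a] by (simp add: prod_eq_iff)
    then show ?thesis
      by (simp add: generate.incl)
  next
    case False
    then have "[a] = inv\<^bsub>free_group\<^esub> [(x, True)]"
      using Cons.prems(2)[of a]
      by (simp add: inv_free_group reduced_Cons inv_letter_def prod_eq_iff)
    then show ?thesis
      by (metis generate.inv singletonI)
  qed
  moreover have "w \<in> generate free_group {[(x, True)]}"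
    using Cons by (simp add: reduced_Cons)
  ultimately have "[a] \<otimes>\<^bsub>free_group\<^esub> w \<in> generate free_group {[(x, True)]}"
    by (rule generate.eng)
  then show ?case
    using Cons.prems(1) by (simp add: free_group_def reduce_reduced)
qed

lemma int_pow_notin_generate:
  assumes "weakly_cyclically_reduced c" "c \<notin> generate free_group {[(x, True)]}"
    and "\<And>a. a \<in> set (c [^]\<^bsub>free_group\<^esub> (k::int)) \<Longrightarrow> fst a = x"
  shows "k = 0"
proof (rule ccontr)
  assume "k \<noteq> 0"
  then have "fst ` set c \<subseteq> {x}"
    using generators_int_pow[OF assms(1), of k] assms(3) by auto
  then show False
    using in_generate_singleton[of c x] assms(1,2)
    by (auto simp: weakly_cyclically_reduced_def)
qed

text \<open>If \<open>g\<^sup>-\<^sup>1 u g\<close> is reduced as it stands, it begins with the inverse of its last letter. As the powers of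
\<open>c\<close> are weakly cyclically reduced, such a conjugate of \<open>u\<close> is no power of \<open>c\<close>.\<close>

lemma conjugate_not_weakly_cyclically_reduced:
  assumes "reduced u" "u \<noteq> []" "reduced g" "g \<noteq> []"
    and "hd g \<noteq> hd u" "hd g \<noteq> inv_letter (last u)"
  shows "reduced (map inv_letter (rev g) @ u @ g)"
    and "\<not> weakly_cyclically_reduced (map inv_letter (rev g) @ u @ g)"
proof -
  have "last (map inv_letter (rev g)) = inv_letter (hd g)"
    using assms(4) by (simp add: last_map last_rev)
  then show "reduced (map inv_letter (rev g) @ u @ g)"
    using assms by (auto simp: reduced_append reduced_inv_word)
  have "hd (map inv_letter (rev g) @ u @ g) = inv_letter (last (map inv_letter (rev g) @ u @ g))"
    using assms(4) by (simp add: hd_append hd_map hd_rev)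
  then show "\<not> weakly_cyclically_reduced (map inv_letter (rev g) @ u @ g)"
    using assms(4) by (auto simp: weakly_cyclically_reduced_def)
qed

text \<open>With four letters available, the first letter of \<open>g\<close> can avoid the two values excluded in the
preceding lemma and one more.\<close>

lemma letter_avoiding:
  obtains x :: "gen letter" where "x \<noteq> a" "x \<noteq> b" "x \<noteq> d"
proof -
  have "card {(Alpha, True), (Alpha, False), (Beta, True), (Beta, False)} = 4"
    by simp
  moreover have "card {a, b, d} \<le> 3"
    by (simp add: card_insert_if)
  ultimately have "\<not> {(Alpha, True), (Alpha, False), (Beta, True), (Beta, False)} \<subseteq> {a, b, d}"
    using card_mono[of "{a, b, d}" "{(Alpha, True), (Alpha, False), (Beta, True), (Beta, False)}"]
    by auto
  then show thesis
    using that by blast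
qed


section \<open>Folding the double\<close>

text \<open>Renaming generators, possibly identifying some, commutes with reduction up to reduction: the renamed
letters act on the reduced words of the target by multiplication from the left, and a word and its
reduced form act in the same way.\<close>

lemma reduce_map_reduce:
  fixes f :: "'g \<Rightarrow> 'h"
  shows "reduce (map (map_prod f id) (reduce w)) = reduce (map (map_prod f id) w)"
proof -
  define \<rho> :: "'g letter \<Rightarrow> 'h word \<Rightarrow> 'h word" where "\<rho> a v = cancel_cons (map_prod f id a) v" for a v
  have "map_prod f id (inv_letter a) = inv_letter (map_prod f id a)" for a :: "'g letter"
    by (simp add: inv_letter_def)
  then interpret letter_action "{v. reduced v}" \<rho>
    using cancel_cons_inv[where a = "inv_letter b" for b]
    by unfold_locales (auto simp: \<rho>_def reduced_cancel_cons)
  have "foldr \<rho> w [] = reduce (map (map_prod f id) w)" for w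
    by (induction w) (simp_all add: \<rho>_def reduce_Cons id_def)
  then show ?thesis
    using foldr_reduce[of "[]" w] by simp
qed

lemma free_group_hom_rename:
  "group_hom free_group free_group (\<lambda>w. reduce (map (map_prod f id) w))"
proof -
  have "(\<lambda>w. reduce (map (map_prod f id) w)) \<in> hom free_group free_group"
    by (rule homI)
      (simp_all add: free_group_def reduced_reduce reduce_map_reduce reduce_append_left
        reduce_append_right)
  then show ?thesis
    by (simp add: group_hom_def group_hom_axioms_def group_free_group)
qed

lemma reduced_map_inj:
  assumes "inj f"
  shows "reduced (map (map_prod f id) w) \<longleftrightarrow> reduced w"
proof -
  have "(map_prod f id b = inv_letter (map_prod f id a)) = (b = inv_letter a)" for a b :: "'a letter"
    using assms by (auto simp: inv_letter_def prod_eq_iff inj_eq)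
  then show ?thesis
    by (simp add: reduced_def successively_map)
qed

text \<open>The folding map of the double onto one factor, which identifies each generator with its primed copy,
as a map on words.\<close>

definition retract :: "('g + 'g) word \<Rightarrow> 'g word" where
  "retract w = reduce (map (map_prod (case_sum id id) id) w)"

interpretation retract: group_hom free_group free_group retract
  unfolding retract_def[abs_def] by (rule free_group_hom_rename)

lemma retract_left: "reduced w \<Longrightarrow> retract (map (map_prod Inl id) w) = w"
  and retract_right: "reduced w \<Longrightarrow> retract (map (map_prod Inr id) w) = w"
  by (simp_all add: retract_def comp_def map_prod_def case_prod_unfold reduce_reduced)

lemma retract_reduce: "retract (reduce w) = retract w"
  by (simp add: retract_def reduce_map_reduce)

lemma retract_append: "retract (u @ v) = reduce (retract u @ retract v)"
  by (simp add: retract_def reduce_append_left reduce_append_right)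

lemma retract_inv_word: "retract (map inv_letter (rev w)) = map inv_letter (rev (retract w))"
proof -
  let ?f = "map_prod (case_sum id id) id :: ('a + 'a) letter \<Rightarrow> _"
  have "map ?f (map inv_letter (rev w)) = map inv_letter (rev (map ?f w))"
    by (simp add: inv_letter_def rev_map map_prod_def case_prod_unfold)
  moreover have "reduce (map inv_letter (rev v)) = map inv_letter (rev (reduce v))" for v :: "'a word"
  proof -
    have "reduce (map inv_letter (rev (reduce v))) =
      reduce (reduce (map inv_letter (rev v) @ v) @ map inv_letter (rev (reduce v)))"
      by (simp add: reduce_inv_word)
    also have "\<dots> = reduce (map inv_letter (rev v) @ reduce (reduce v @ map inv_letter (rev (reduce v))))"
      by (simp add: reduce_append_left reduce_append_right)
    also have "reduce (reduce v @ map inv_letter (rev (reduce v))) = []"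
      using reduce_inv_word[of "map inv_letter (rev (reduce v))"] by (simp add: rev_map comp_def)
    finally show ?thesis
      by (simp add: reduce_reduced reduced_inv_word reduced_reduce)
  qed
  ultimately show ?thesis
    by (simp add: retract_def)
qed


section \<open>The double of a word and the cosets of the amalgamated subgroup\<close>

type_synonym point = "(gen + gen) word set + int"

instance gen :: countable
  by countable_datatype

text \<open>The multiple \<open>k\<close> records the divisibility in the definition of a special word: it makes
\<open>\<alpha> \<mapsto> - k\<close>, \<open>\<beta> \<mapsto> 1\<close> a homomorphism to the integers that kills \<open>c\<close>.\<close>

locale doubled_word =
  fixes c :: "gen word" and k :: int
  assumes wcr: "weakly_cyclically_reduced c"
    and not_power: "c \<notin> generate free_group {[(Beta, True)]}"
    and exponents: "exponent_sum Beta c = k * exponent_sum Alpha c"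
begin

definition left_c :: "(gen + gen) word" where "left_c = map (map_prod Inl id) c"
definition right_c :: "(gen + gen) word" where "right_c = map (map_prod Inr id) c"

text \<open>The amalgam is the quotient by \<open>N\<close>, and \<open>M\<close> is the preimage in the free group of the amalgamated cyclic
subgroup. Cosets of \<open>M\<close> in the free group therefore stand for cosets of \<open>\<langle>c\<rangle>\<close> in the amalgam.\<close>

definition N :: "(gen + gen) word set" where
  "N = normal_closure free_group
    {u \<otimes>\<^bsub>free_group\<^esub> inv\<^bsub>free_group\<^esub> v | u v. (u, v) \<in> {(left_c, right_c)}}"

definition M :: "(gen + gen) word set" where
  "M = N <#>\<^bsub>free_group\<^esub> generate free_group {left_c}"

lemma reduced_c: "reduced c" "reduced left_c" "reduced right_c"
  using wcr by (simp_all add: weakly_cyclically_reduced_def left_c_def right_c_def reduced_map_inj)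

lemma c_nonempty: "c \<noteq> []"
  using not_power generate.one[of free_group] by (auto simp: free_group_def)

lemma normal_N: "N \<lhd> free_group"
  unfolding N_def
  using reduced_c by (intro free_group.normal_normal_closure) (auto simp flip: in_free_group)

lemma relator_in_N: "left_c \<otimes>\<^bsub>free_group\<^esub> inv\<^bsub>free_group\<^esub> right_c \<in> N"
  by (auto simp: N_def normal_closure_def)

lemma N_retract:
  assumes "w \<in> N"
  shows "retract w = []"
proof -
  have "left_c \<otimes>\<^bsub>free_group\<^esub> inv\<^bsub>free_group\<^esub> right_c \<in> kernel free_group free_group retract"
    using reduced_c
    by (simp add: kernel_def left_c_def right_c_def retract_left retract_right flip: in_free_group)
  then have "N \<subseteq> kernel free_group free_group retract"
    unfolding N_def normal_closure_def using retract.normal_kernel by (intro Inter_lower) auto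
  then show ?thesis
    using assms by (auto simp: kernel_def free_group_def)
qed

lemma subgroup_M: "subgroup M free_group"
  unfolding M_def
  using normal_N reduced_c
  by (intro second_isomorphism_grp.normal_set_mult_subgroup second_isomorphism_grp.intro
      second_isomorphism_grp_axioms.intro free_group.generate_is_subgroup)
    (simp_all add: in_free_group)

lemma N_subset_M: "N \<subseteq> M" and left_c_in_M: "left_c \<in> M"
proof -
  interpret N: subgroup N free_group
    using normal_N by (rule normal_imp_subgroup)
  show "N \<subseteq> M"
  proof
    fix n assume "n \<in> N"
    then have "n = n \<otimes>\<^bsub>free_group\<^esub> \<one>\<^bsub>free_group\<^esub>" by (simp add: N.mem_carrier)
    with \<open>n \<in> N\<close> show "n \<in> M"
      unfolding M_def set_mult_def using generate.one by blast
  qed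
  have "left_c = \<one>\<^bsub>free_group\<^esub> \<otimes>\<^bsub>free_group\<^esub> left_c"
    using reduced_c by (simp add: in_free_group)
  then show "left_c \<in> M"
    unfolding M_def set_mult_def using N.one_closed generate.incl[of left_c "{left_c}"] by blast
qed

text \<open>The retraction embeds \<open>\<langle>c\<rangle>\<close>: an element of \<open>M\<close> is \<open>c\<^sup>j\<close> modulo \<open>N\<close>, and the retraction,
which kills \<open>N\<close>, takes it to the same power of \<open>c\<close> in the free group of rank two.\<close>

lemma M_retract:
  assumes "m \<in> M"
  obtains j :: int where "retract m = c [^]\<^bsub>free_group\<^esub> j" "j = 0 \<Longrightarrow> m \<in> N"
proof -
  have c: "left_c \<in> carrier free_group"
    using reduced_c by (simp add: in_free_group)
  obtain n j where n: "n \<in> N" and m: "m = n \<otimes>\<^bsub>free_group\<^esub> left_c [^]\<^bsub>free_group\<^esub> (j::int)"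
    using assms by (auto simp: M_def set_mult_def free_group.generate_pow[OF c])
  have n': "n \<in> carrier free_group"
    using n normal_imp_subgroup[OF normal_N] by (rule subgroup.mem_carrier[rotated])
  have retract_n: "retract n = \<one>\<^bsub>free_group\<^esub>"
    using N_retract[OF n] by (simp add: free_group_def)
  have "retract m = \<one>\<^bsub>free_group\<^esub> \<otimes>\<^bsub>free_group\<^esub> retract left_c [^]\<^bsub>free_group\<^esub> j"
    using n' c retract_n by (simp add: m retract.hom_int_pow)
  also have "\<dots> = c [^]\<^bsub>free_group\<^esub> j"
    using reduced_c free_group.int_pow_closed[of c j]
    by (simp add: left_c_def retract_left in_free_group free_group.l_one)
  finally show thesis
    using that[of j] n n' by (simp add: m)
qed

definition cosets :: "(gen + gen) word set set" where
  "cosets = (\<lambda>g. g <#\<^bsub>free_group\<^esub> M) ` carrier free_group"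

lemma M_in_cosets: "M \<in> cosets"
proof -
  have "[] <#\<^bsub>free_group\<^esub> M = M"
    using free_group.lcos_mult_one[OF subgroup.subset[OF subgroup_M]]
    by (simp add: free_group_def)
  then show ?thesis
    by (force simp: cosets_def in_free_group)
qed

lemma l_coset_l_coset:
  assumes "reduced u" "reduced g"
  shows "u <#\<^bsub>free_group\<^esub> (g <#\<^bsub>free_group\<^esub> M) = reduce (u @ g) <#\<^bsub>free_group\<^esub> M"
  using free_group.lcos_m_assoc[OF subgroup.subset[OF subgroup_M], of u g] assms
  by (simp add: free_group_def)

lemma l_coset_eqD:
  assumes "reduced g" "reduced h" "g <#\<^bsub>free_group\<^esub> M = h <#\<^bsub>free_group\<^esub> M"
  shows "reduce (map inv_letter (rev h) @ g) \<in> M"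
proof -
  have "g \<in> h <#\<^bsub>free_group\<^esub> M"
    using group.lcos_self[OF group_free_group _ subgroup_M] assms by (auto simp: in_free_group)
  then have "inv\<^bsub>free_group\<^esub> h \<otimes>\<^bsub>free_group\<^esub> g \<in> M"
    using subgroup.lcos_module_imp[OF subgroup_M group_free_group] assms by (simp add: in_free_group)
  then show ?thesis
    using assms by (simp add: inv_free_group) (simp add: free_group_def)
qed

text \<open>This is where normality enters: \<open>n h = h n'\<close> with \<open>n' \<in> N \<subseteq> M\<close>.\<close>

lemma N_acts_trivially:
  assumes n: "n \<in> N" and h: "h \<in> carrier free_group"
  shows "(n \<otimes>\<^bsub>free_group\<^esub> h) <#\<^bsub>free_group\<^esub> M = h <#\<^bsub>free_group\<^esub> M"
proof -
  have M: "M \<subseteq> carrier free_group"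
    by (rule subgroup.subset[OF subgroup_M])
  define n' where "n' = inv\<^bsub>free_group\<^esub> h \<otimes>\<^bsub>free_group\<^esub> n \<otimes>\<^bsub>free_group\<^esub> h"
  have "n' \<in> M"
    using normal.inv_op_closed1[OF normal_N h n] N_subset_M by (auto simp: n'_def)
  then have n': "n' <#\<^bsub>free_group\<^esub> M = M" "n' \<in> carrier free_group"
    using free_group.coset_join3[OF _ subgroup_M] M by auto
  have "n \<otimes>\<^bsub>free_group\<^esub> h = h \<otimes>\<^bsub>free_group\<^esub> n'"
    using n N_subset_M M h by (auto simp: n'_def free_group.m_assoc[symmetric])
  then show ?thesis
    using free_group.lcos_m_assoc[OF M h n'(2)] n'(1) by simp
qed

lemma left_c_right_c_coset:
  assumes "S \<in> cosets"
  shows "left_c <#\<^bsub>free_group\<^esub> S = right_c <#\<^bsub>free_group\<^esub> S"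
proof -
  have M: "M \<subseteq> carrier free_group"
    by (rule subgroup.subset[OF subgroup_M])
  have cc: "left_c \<in> carrier free_group" "right_c \<in> carrier free_group"
    using reduced_c by (simp_all add: in_free_group)
  obtain g where g: "g \<in> carrier free_group" and S: "S = g <#\<^bsub>free_group\<^esub> M"
    using assms by (auto simp: cosets_def)
  have cancel: "inv\<^bsub>free_group\<^esub> right_c \<otimes>\<^bsub>free_group\<^esub> (right_c \<otimes>\<^bsub>free_group\<^esub> g) = g"
    using g cc by (metis free_group.inv_closed free_group.l_inv free_group.l_one free_group.m_assoc)
  have "left_c \<otimes>\<^bsub>free_group\<^esub> g
      = (left_c \<otimes>\<^bsub>free_group\<^esub> inv\<^bsub>free_group\<^esub> right_c) \<otimes>\<^bsub>free_group\<^esub> (right_c \<otimes>\<^bsub>free_group\<^esub> g)"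
    using g cc by (simp add: free_group.m_assoc cancel)
  then have "(left_c \<otimes>\<^bsub>free_group\<^esub> g) <#\<^bsub>free_group\<^esub> M
      = (right_c \<otimes>\<^bsub>free_group\<^esub> g) <#\<^bsub>free_group\<^esub> M"
    using N_acts_trivially[OF relator_in_N] g cc by simp
  then show ?thesis
    using g cc M by (simp add: S free_group.lcos_m_assoc)
qed

lemma left_c_fixes_M: "left_c <#\<^bsub>free_group\<^esub> M = M"
  using free_group.coset_join3[OF _ subgroup_M left_c_in_M] reduced_c
  by (simp add: in_free_group)


section \<open>Gluing the coset space to a line\<close>

definition points :: "point set" where
  "points = Inl ` cosets \<union> range Inr"

definition shift :: "(gen + gen) letter \<Rightarrow> int" where
  "shift a = (if snd a then 1 else -1) * (case case_sum id id (fst a) of Alpha \<Rightarrow> - k | Beta \<Rightarrow> 1)"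

text \<open>The action of the amalgam on the disjoint union of the coset space and the integers, before gluing. It
preserves both parts.\<close>

definition split_act :: "(gen + gen) letter \<Rightarrow> point \<Rightarrow> point" where
  "split_act a = map_sum (\<lambda>S. [a] <#\<^bsub>free_group\<^esub> S) (\<lambda>i. i + shift a)"

definition swap :: "point \<Rightarrow> point" where
  "swap = transpose (Inl M) (Inr 0)"

text \<open>The generators of the left factor are conjugated by the transposition that exchanges the coset \<open>M\<close>
with the integer \<open>0\<close>; the generators of the right factor keep their action. The two parts are
thereby joined.\<close>

definition glued_act :: "(gen + gen) letter \<Rightarrow> point \<Rightarrow> point" where
  "glued_act a y = (if isl (fst a) then swap (split_act a (swap y)) else split_act a y)"

lemma shift_inv_letter: "shift (inv_letter a) = - shift a"
  by (simp add: shift_def inv_letter_def)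

lemma isl_inv_letter: "isl (fst (inv_letter a)) = isl (fst a)"
  by (simp add: inv_letter_def)

lemma in_points: "Inl S \<in> points \<longleftrightarrow> S \<in> cosets" "Inr i \<in> points"
  by (auto simp: points_def)

lemma letter_l_coset_cosets:
  assumes "S \<in> cosets"
  shows "[a] <#\<^bsub>free_group\<^esub> S \<in> cosets"
    and "[inv_letter a] <#\<^bsub>free_group\<^esub> ([a] <#\<^bsub>free_group\<^esub> S) = S"
proof -
  obtain g where g: "reduced g" "S = g <#\<^bsub>free_group\<^esub> M"
    using assms by (auto simp: cosets_def in_free_group)
  have 1: "[a] <#\<^bsub>free_group\<^esub> S = cancel_cons a g <#\<^bsub>free_group\<^esub> M"
    using g by (simp add: l_coset_l_coset reduced_Cons reduce_Cons reduce_reduced)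
  then show "[a] <#\<^bsub>free_group\<^esub> S \<in> cosets"
    using g(1) by (auto simp: cosets_def in_free_group reduced_cancel_cons)
  show "[inv_letter a] <#\<^bsub>free_group\<^esub> ([a] <#\<^bsub>free_group\<^esub> S) = S"
    using g cancel_cons_inv[of g "inv_letter a"] unfolding 1
    by (simp add: l_coset_l_coset reduced_Cons reduce_Cons reduce_reduced reduced_cancel_cons)
qed

sublocale split_act: letter_action points split_act
proof
  fix y a assume "y \<in> points"
  then show "split_act a y \<in> points" "split_act (inv_letter a) (split_act a y) = y"
    by (auto simp: points_def split_act_def letter_l_coset_cosets shift_inv_letter)
qed

lemma swap_points: "swap y \<in> points \<longleftrightarrow> y \<in> points"
  using M_in_cosets by (auto simp: swap_def transpose_def in_points)

sublocale glued_act: letter_action points glued_act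
proof
  fix y a assume "y \<in> points"
  then show "glued_act a y \<in> points" "glued_act (inv_letter a) (glued_act a y) = y"
    by (auto simp: glued_act_def isl_inv_letter swap_points split_act.letter_closed
        split_act.letter_cancel)
      (simp_all add: swap_def split_act.letter_cancel swap_points[unfolded swap_def])
qed

lemma split_act_coset:
  assumes "reduced g"
  shows "foldr split_act w (Inl (g <#\<^bsub>free_group\<^esub> M))
    = Inl (reduce (w @ g) <#\<^bsub>free_group\<^esub> M)"
  by (induction w)
    (simp_all add: split_act_def l_coset_l_coset reduced_Cons reduce_Cons reduced_reduce
      reduce_reduced assms)

lemma split_act_integer: "foldr split_act w (Inr i) = Inr (i + sum_list (map shift w))"
  by (induction w) (simp_all add: split_act_def)

lemma shift_c: "sum_list (map shift left_c) = 0" "sum_list (map shift right_c) = 0"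
proof -
  have *: "sum_list (map shift (map (map_prod f id) w)) = exponent_sum Beta w - k * exponent_sum Alpha w"
    if "case_sum id id \<circ> f = id" for f w
  proof (induction w)
    case (Cons a w)
    have "case_sum id id (f (fst a)) = fst a"
      using that by (metis comp_apply id_apply)
    then have "shift (map_prod f id a)
        = (if snd a then 1 else -1) * (case fst a of Alpha \<Rightarrow> - k | Beta \<Rightarrow> 1)"
      by (simp add: shift_def)
    with Cons show ?case
      by (cases a; cases "fst a") (auto simp: exponent_sum_def algebra_simps)
  qed (simp add: exponent_sum_def)
  have "case_sum id id \<circ> Inl = (id :: gen \<Rightarrow> gen)" "case_sum id id \<circ> Inr = (id :: gen \<Rightarrow> gen)"
    by auto
  from this[THEN *, of c] show "sum_list (map shift left_c) = 0" "sum_list (map shift right_c) = 0"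
    unfolding left_c_def right_c_def exponents by simp_all
qed

lemma split_act_left_c_right_c:
  assumes "y \<in> points"
  shows "foldr split_act left_c y = foldr split_act right_c y"
proof (cases y)
  case (Inl S)
  then obtain g where g: "reduced g" "S = g <#\<^bsub>free_group\<^esub> M"
    using assms by (auto simp: in_points cosets_def in_free_group)
  then show ?thesis
    using left_c_right_c_coset[of S] Inl assms reduced_c
    by (simp add: split_act_coset in_points l_coset_l_coset)
next
  case (Inr i)
  then show ?thesis
    by (simp add: split_act_integer shift_c)
qed

text \<open>Both points exchanged by the transposition are fixed by \<open>c\<close>: the coset \<open>M\<close> since \<open>c \<in> M\<close>, the
integers since \<open>c\<close> is in the kernel of the homomorphism to the integers.\<close>

lemma split_act_left_c_fixed:
  "foldr split_act left_c (Inl M) = Inl M"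
  "foldr split_act left_c (Inr i) = Inr i"
proof -
  have "M = [] <#\<^bsub>free_group\<^esub> M"
    using free_group.lcos_mult_one[OF subgroup.subset[OF subgroup_M]] by (simp add: free_group_def)
  then show "foldr split_act left_c (Inl M) = Inl M"
    using split_act_coset[of "[]" left_c] left_c_fixes_M reduced_c by (simp add: reduce_reduced)
qed (simp add: split_act_integer shift_c)

lemma glued_act_left:
  "foldr glued_act (map (map_prod Inl id) w) y
    = swap (foldr split_act (map (map_prod Inl id) w) (swap y))"
  by (induction w) (simp_all add: glued_act_def swap_def)

lemma glued_act_right:
  "foldr glued_act (map (map_prod Inr id) w) y
    = foldr split_act (map (map_prod Inr id) w) y"
  by (induction w) (simp_all add: glued_act_def)

text \<open>A permutation that fixes both points exchanged by a transposition commutes with it. So conjugation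
does not change the action of \<open>c(\<alpha>, \<beta>)\<close>, which still agrees with that of \<open>c(\<alpha>', \<beta>')\<close>.\<close>

lemma glued_act_relation:
  assumes y: "y \<in> points"
  shows "foldr glued_act left_c y = foldr glued_act right_c y"
proof -
  have inj: "foldr split_act left_c x = foldr split_act left_c y \<Longrightarrow> x = y" if "x \<in> points" for x
    using split_act.foldr_bij[of left_c] y that by (auto simp: bij_betw_def dest: inj_onD)
  have "swap (foldr split_act left_c (swap y)) = foldr split_act left_c y"
  proof (cases "y = Inl M \<or> y = Inr 0")
    case True
    then show ?thesis
      by (auto simp: swap_def split_act_left_c_fixed)
  next
    case False
    then have "foldr split_act left_c y \<noteq> Inl M" "foldr split_act left_c y \<noteq> Inr 0"
      using inj[of "Inl M"] inj[of "Inr 0"] M_in_cosets by (auto simp: split_act_left_c_fixed in_points)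
    with False show ?thesis
      by (simp add: swap_def)
  qed
  then show ?thesis
    using split_act_left_c_right_c[OF y]
    by (simp add: left_c_def right_c_def glued_act_left glued_act_right)
qed

text \<open>The orbit \<open>P\<close> of \<open>0\<close> contains all integers, as \<open>\<beta>'\<close> still shifts them, and it contains \<open>M\<close>, as the
conjugated \<open>\<beta>\<close> takes \<open>M\<close>, which now sits in the place of \<open>0\<close>, to the integer \<open>1\<close>. Hence \<open>P\<close> is
invariant under the transposition, so it is invariant under the original generators too, and these act
transitively on the cosets.\<close>

lemma glued_act_transitive:
  assumes "y \<in> points"
  shows "\<exists>w. foldr glued_act w (Inr 0) = y"
proof -
  define P where "P = {foldr glued_act w (Inr 0) | w. True}"
  have base: "Inr 0 \<in> P"
    unfolding P_def by (rule CollectI, rule exI[of _ "[]"]) simp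
  have closed: "glued_act a x \<in> P" if x: "x \<in> P" for a x
  proof -
    obtain w where "x = foldr glued_act w (Inr 0)"
      using x by (auto simp: P_def)
    then have "glued_act a x = foldr glued_act (a # w) (Inr 0)"
      by simp
    then show ?thesis
      unfolding P_def by blast
  qed
  have up: "Inr (i + 1) \<in> P" and down: "Inr (i - 1) \<in> P" if "Inr i \<in> P" for i
    using closed[OF that, of "(Inr Beta, True)"] closed[OF that, of "(Inr Beta, False)"]
    by (simp_all add: glued_act_def split_act_def shift_def)
  have integers: "Inr i \<in> P" for i
    by (induction i rule: int_induct[where k = 0]) (use base up down in auto)
  \<comment> \<open>the inverse of \<open>\<beta>\<close> leads from \<open>1\<close> to \<open>0\<close>, which the transposition replaces by \<open>M\<close>\<close>
  have "Inl M \<in> P"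
    using closed[OF integers[of 1], of "(Inl Beta, False)"]
    by (simp add: glued_act_def split_act_def shift_def swap_def)
  with base have swap: "swap x \<in> P" if "x \<in> P" for x
    using that by (simp add: swap_def transpose_def)
  have split_act_closed: "split_act a x \<in> P" if "x \<in> P" for a x
  proof (cases "isl (fst a)")
    case True
    then have "split_act a x = swap (glued_act a (swap x))"
      by (simp add: glued_act_def swap_def)
    then show ?thesis
      using that swap closed by simp
  next
    case False
    then have "split_act a x = glued_act a x" by (simp add: glued_act_def)
    then show ?thesis
      using closed[OF that] by simp
  qed
  have "foldr split_act w (Inl M) \<in> P" for w
    by (induction w) (simp_all add: \<open>Inl M \<in> P\<close> split_act_closed)
  moreover have "Inl (g <#\<^bsub>free_group\<^esub> M) = foldr split_act g (Inl M)" if "reduced g" for g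
    using split_act_coset[of "[]" g] free_group.lcos_mult_one[OF subgroup.subset[OF subgroup_M]] that
    by (simp add: reduce_reduced free_group_def)
  ultimately have "points \<subseteq> P"
    using integers by (auto simp: points_def cosets_def in_free_group)
  then show ?thesis
    using assms by (auto simp: P_def)
qed

text \<open>A path that starts at a coset and avoids \<open>M\<close> is not affected by the gluing; it cannot meet \<open>0\<close>, the
other exchanged point, because the original action preserves the coset space.\<close>

lemma glued_act_eq_split_act:
  assumes "S \<in> cosets" and avoid: "\<And>u v. w = u @ v \<Longrightarrow> foldr split_act v (Inl S) \<noteq> Inl M"
  shows "foldr glued_act w (Inl S) = foldr split_act w (Inl S)"
  using avoid
proof (induction w)
  case (Cons a w)
  have coset: "\<exists>T\<in>cosets. foldr split_act v (Inl S) = Inl T" for v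
    by (induction v) (use assms(1) in \<open>auto simp: split_act_def letter_l_coset_cosets\<close>)
  have swap: "swap (foldr split_act v (Inl S)) = foldr split_act v (Inl S)"
    if "foldr split_act v (Inl S) \<noteq> Inl M" for v
    using that coset[of v] by (auto simp: swap_def)
  have "foldr glued_act w (Inl S) = foldr split_act w (Inl S)"
    using Cons.IH Cons.prems[of "a # u" for u] by simp
  moreover have "foldr split_act w (Inl S) \<noteq> Inl M" "foldr split_act (a # w) (Inl S) \<noteq> Inl M"
    using Cons.prems[of "[a]" w] Cons.prems[of "[]" "a # w"] by auto
  moreover have "foldr glued_act (a # w) (Inl S) = glued_act a (foldr glued_act w (Inl S))"
    by simp
  ultimately have "foldr glued_act (a # w) (Inl S) = glued_act a (foldr split_act w (Inl S))"
    by simp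
  also have "\<dots> = foldr split_act (a # w) (Inl S)"
    using swap[OF \<open>foldr split_act w (Inl S) \<noteq> Inl M\<close>]
      swap[OF \<open>foldr split_act (a # w) (Inl S) \<noteq> Inl M\<close>]
    by (simp add: glued_act_def)
  finally show ?case .
qed simp

text \<open>The retraction carries an equality of cosets of \<open>M\<close> to an equality of cosets of \<open>\<langle>c\<rangle>\<close> in the free
group of rank two, where it can be tested on reduced words. The exponent \<open>j\<close> remembers enough of what
the retraction forgets: if it vanishes, \<open>g\<close> and \<open>h\<close> agree already in the amalgam.\<close>

lemma coset_eq_retract:
  assumes "reduced g" "reduced h" "g <#\<^bsub>free_group\<^esub> M = h <#\<^bsub>free_group\<^esub> M"
  obtains j :: int where
    "reduce (map inv_letter (rev (retract h)) @ retract g) = c [^]\<^bsub>free_group\<^esub> j"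
    "j = 0 \<Longrightarrow> reduce (map inv_letter (rev h) @ g) \<in> N"
proof -
  obtain j :: int where "retract (reduce (map inv_letter (rev h) @ g)) = c [^]\<^bsub>free_group\<^esub> j"
    "j = 0 \<Longrightarrow> reduce (map inv_letter (rev h) @ g) \<in> N"
    using M_retract[OF l_coset_eqD[OF assms]] by metis
  then show thesis
    using that by (simp add: retract_reduce retract_append retract_inv_word)
qed

text \<open>Let \<open>w \<notin> N\<close> and let \<open>u\<close> be its image under the retraction. The cosets of \<open>g m = x \<beta>\<^sup>m\<close> serve as
starting points, where the letter \<open>x\<close> is such that \<open>g\<^sup>-\<^sup>1 u g\<close> is reduced as it stands if \<open>u\<close> is not
empty. For each suffix \<open>v\<close> of \<open>w\<close> at most one of these cosets is sent to \<open>M\<close> by \<open>v\<close>, since no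
nontrivial power of \<open>\<beta>\<close> is in \<open>\<langle>c\<rangle>\<close>; so for some \<open>m\<close> the path of \<open>w\<close> avoids \<open>M\<close> and \<open>w\<close> acts
as before the gluing. If it fixes that coset, then \<open>g\<^sup>-\<^sup>1 w g\<close> is a power \<open>c\<^sup>j\<close> in the amalgam. For
nonempty \<open>u\<close> this contradicts the choice of \<open>x\<close> after retraction; for empty \<open>u\<close> the retraction shows
\<open>c\<^sup>j = 1\<close>, so \<open>j = 0\<close> and \<open>w \<in> N\<close>.\<close>

lemma glued_act_faithful:
  assumes w: "reduced w" "w \<notin> N"
  shows "\<exists>y\<in>points. foldr glued_act w y \<noteq> y"
proof -
  define u where "u = retract w"
  obtain x :: "gen letter" where x: "x \<noteq> hd u" "x \<noteq> inv_letter (last u)" "x \<noteq> (Beta, False)"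
    by (rule letter_avoiding)
  define g where "g m = x # replicate m (Beta, True)" for m
  define g' :: "nat \<Rightarrow> (gen + gen) word" where "g' m = map (map_prod Inl id) (g m)" for m
  have "reduced (y # replicate m (Beta, True))" if "y \<noteq> (Beta, False)" for y m
    using that
  proof (induction m arbitrary: y)
    case (Suc m)
    have "reduced ((Beta, True) # replicate m (Beta, True))"
      by (rule Suc.IH) simp
    then show ?case
      using Suc.prems by (subst reduced_Cons) (auto simp: inv_letter_def prod_eq_iff)
  qed (simp add: reduced_Cons)
  then have g: "reduced (g m)" for m
    using x(3) by (simp add: g_def)
  have g': "reduced (g' m)" "retract (g' m) = g m" for m
    using g by (simp_all add: g'_def reduced_map_inj retract_left)
  \<comment> \<open>the exponents for which the path of \<open>w\<close> meets \<open>M\<close> after the suffix \<open>v\<close>\<close>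
  define bad where "bad v = {m. reduce (v @ g' m) <#\<^bsub>free_group\<^esub> M = M}" for v
  have bad_le: "m = n" if "m \<in> bad v" "n \<in> bad v" "n \<le> m" for m n v
  proof -
    have "foldr split_act v (Inl (g' m <#\<^bsub>free_group\<^esub> M))
        = foldr split_act v (Inl (g' n <#\<^bsub>free_group\<^esub> M))"
      using that(1,2) g' by (simp add: split_act_coset bad_def)
    moreover have "Inl (g' l <#\<^bsub>free_group\<^esub> M) \<in> points" for l
      using g' by (auto simp: in_points cosets_def in_free_group)
    ultimately have eq: "g' m <#\<^bsub>free_group\<^esub> M = g' n <#\<^bsub>free_group\<^esub> M"
      using split_act.foldr_bij[of v] by (auto simp: bij_betw_def dest!: inj_onD)
    obtain j :: int where "reduce (map inv_letter (rev (g n)) @ g m) = c [^]\<^bsub>free_group\<^esub> j"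
      using coset_eq_retract[OF g'(1) g'(1) eq] g'(2) by metis
    moreover have "g m = g n @ replicate (m - n) (Beta, True)"
      using that(3) by (simp add: g_def flip: replicate_add)
    moreover have "reduced (replicate (m - n) (Beta, True))"
      using g[of "m - n"] by (simp add: g_def reduced_Cons)
    ultimately have j: "c [^]\<^bsub>free_group\<^esub> j = replicate (m - n) (Beta, True)"
      using reduce_append_left[of "map inv_letter (rev (g n)) @ g n" "replicate (m - n) (Beta, True)"]
      by (simp add: reduce_inv_word reduce_reduced)
    then have "j = 0"
      by (intro int_pow_notin_generate[OF wcr not_power]) auto
    with j have "replicate (m - n) (Beta, True) = []"
      using int_pow_eq_Nil_iff[OF wcr c_nonempty, of j] by simp
    then show ?thesis
      using that(3) by simp
  qed
  then have bad: "m = n" if "m \<in> bad v" "n \<in> bad v" for m n v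
    using that by (metis nle_le)
  have "finite (bad v)" for v
  proof (cases "bad v = {}")
    case False
    then obtain m where "m \<in> bad v" by blast
    with bad have "bad v \<subseteq> {m}" by blast
    then show ?thesis by (rule finite_subset) simp
  qed simp
  moreover have "{v. \<exists>u. w = u @ v} \<subseteq> (\<lambda>i. drop i w) ` {..length w}"
  proof clarify
    fix u v assume "w = u @ v"
    then show "v \<in> (\<lambda>i. drop i (u @ v)) ` {..length (u @ v)}"
      by (intro image_eqI[of _ _ "length u"]) simp_all
  qed
  then have "finite {v. \<exists>u. w = u @ v}"
    by (rule finite_subset) simp
  ultimately have "finite (\<Union>v\<in>{v. \<exists>u. w = u @ v}. bad v)"
    by blast
  then obtain m where m: "m \<notin> (\<Union>v\<in>{v. \<exists>u. w = u @ v}. bad v)"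
    using ex_new_if_finite[OF infinite_UNIV_nat] by blast
  define S where "S = g' m <#\<^bsub>free_group\<^esub> M"
  have S: "S \<in> cosets"
    using g' by (auto simp: S_def cosets_def in_free_group)
  have "foldr split_act v (Inl S) \<noteq> Inl M" if "w = u @ v" for u v
    using m that g' by (auto simp: S_def split_act_coset bad_def)
  then have "foldr glued_act w (Inl S) = foldr split_act w (Inl S)"
    by (rule glued_act_eq_split_act[OF S])
  moreover have "foldr split_act w (Inl S) \<noteq> Inl S"
  proof
    assume "foldr split_act w (Inl S) = Inl S"
    then have eq: "reduce (w @ g' m) <#\<^bsub>free_group\<^esub> M = g' m <#\<^bsub>free_group\<^esub> M"
      using g' by (simp add: S_def split_act_coset)
    obtain j :: int where j:
      "reduce (map inv_letter (rev (g m)) @ reduce (u @ g m)) = c [^]\<^bsub>free_group\<^esub> j"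
      "j = 0 \<Longrightarrow> reduce (map inv_letter (rev (g' m)) @ w @ g' m) \<in> N"
      using coset_eq_retract[OF reduced_reduce _ eq] g'
      by (auto simp: retract_reduce retract_append u_def reduce_append_right)
    show False
    proof (cases "u = []")
      case True
      then have "c [^]\<^bsub>free_group\<^esub> j = []"
        using j(1) g by (simp add: reduce_reduced reduce_inv_word)
      then have "j = 0"
        using int_pow_eq_Nil_iff[OF wcr c_nonempty] by simp
      then have n: "reduce (map inv_letter (rev (g' m)) @ w @ g' m) \<in> N"
        by (rule j(2))
      have "g' m \<otimes>\<^bsub>free_group\<^esub> reduce (map inv_letter (rev (g' m)) @ w @ g' m)
          \<otimes>\<^bsub>free_group\<^esub> inv\<^bsub>free_group\<^esub> g' m \<in> N"
        using normal.inv_op_closed2[OF normal_N _ n] g' by (simp add: in_free_group)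
      moreover have "reduce (map inv_letter (rev (g' m)) @ w @ g' m)
          = inv\<^bsub>free_group\<^esub> g' m \<otimes>\<^bsub>free_group\<^esub> (w \<otimes>\<^bsub>free_group\<^esub> g' m)"
        using g' by (simp add: inv_free_group) (simp add: free_group_def reduce_append_right)
      ultimately have "w \<in> N"
        using g'(1)[of m] w(1)
        by (simp flip: in_free_group add: free_group.m_assoc)
          (simp flip: free_group.m_assoc)
      with w show False by simp
    next
      case False
      have "reduced (map inv_letter (rev (g m)) @ u @ g m)"
        "\<not> weakly_cyclically_reduced (map inv_letter (rev (g m)) @ u @ g m)"
        using conjugate_not_weakly_cyclically_reduced[of u "g m"] False g x
        by (auto simp: g_def u_def retract_def reduced_reduce)
      then show False
        using j(1) weakly_cyclically_reduced_int_pow[OF wcr, of j]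
        by (simp add: reduce_append_right reduce_reduced)
    qed
  qed
  ultimately show ?thesis
    using S by (intro bexI[of _ "Inl S"]) (auto simp: in_points)
qed

text \<open>On the line a letter acts as a translation by \<open>t\<close>, except possibly at \<open>0\<close> and at the point \<open>- t\<close> that
the translation takes to \<open>0\<close>. So the number of points that leave an interval is bounded independently
of its length.\<close>

lemma glued_act_Folner:
  "(\<lambda>n. card (glued_act a ` Inr ` {0..int n} - Inr ` {0..int n})
      / card (Inr ` {0..int n} :: point set))
    \<longlonglongrightarrow> 0"
proof -
  define t where "t = shift a"
  have generic: "glued_act a (Inr i) = Inr (i + t)" if "i \<noteq> 0" "i \<noteq> - t" for i
    using that by (auto simp: glued_act_def swap_def split_act_def t_def transpose_def)
  have bound: "card (glued_act a ` Inr ` {0..int n} - Inr ` {0..int n}) \<le> 2 + 2 * nat \<bar>t\<bar>" for n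
  proof -
    have "glued_act a ` Inr ` {0..int n} - Inr ` {0..int n}
      \<subseteq> glued_act a ` Inr ` {0, - t} \<union> (Inr ` {- \<bar>t\<bar>..<0} \<union> Inr ` {int n<..int n + \<bar>t\<bar>})"
    proof
      fix y assume "y \<in> glued_act a ` Inr ` {0..int n} - Inr ` {0..int n}"
      then obtain i where i: "i \<in> {0..int n}" "y = glued_act a (Inr i)" "y \<notin> Inr ` {0..int n}"
        by auto
      show "y \<in> glued_act a ` Inr ` {0, - t} \<union> (Inr ` {- \<bar>t\<bar>..<0} \<union> Inr ` {int n<..int n + \<bar>t\<bar>})"
      proof (cases "i \<in> {0, - t}")
        case True
        then show ?thesis using i(2) by blast
      next
        case False
        then have y: "y = Inr (i + t)"
          using generic i(2) by simp
        with i(1,3) have "i + t \<in> {- \<bar>t\<bar>..<0} \<union> {int n<..int n + \<bar>t\<bar>}"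
          by auto
        with y show ?thesis by blast
      qed
    qed
    then have "card (glued_act a ` Inr ` {0..int n} - Inr ` {0..int n})
      \<le> card (glued_act a ` Inr ` {0, - t} \<union> (Inr ` {- \<bar>t\<bar>..<0} \<union> Inr ` {int n<..int n + \<bar>t\<bar>}))"
      by (rule card_mono[rotated]) simp
    also have "\<dots> \<le> card (glued_act a ` Inr ` {0, - t})
        + (card (Inr ` {- \<bar>t\<bar>..<0} :: point set)
          + card (Inr ` {int n<..int n + \<bar>t\<bar>} :: point set))"
      by (meson add_left_mono card_Un_le order_trans)
    also have "card (glued_act a ` Inr ` {0, - t}) \<le> 2"
      by (simp add: card_insert_if)
    finally show ?thesis
      by (simp add: card_image)
  qed
  have lim: "(\<lambda>n. real (2 + 2 * nat \<bar>t\<bar>) / real (Suc n)) \<longlonglongrightarrow> 0"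
    by (rule LIMSEQ_Suc[OF lim_const_over_n])
  have size: "card (Inr ` {0..int n} :: point set) = Suc n" for n
    by (simp add: card_image)
  show ?thesis
    unfolding size
    by (intro tendsto_sandwich[OF _ _ tendsto_const lim] always_eventually allI divide_right_mono
        of_nat_mono bound) simp_all
qed

lemma countable_points: "countable points"
  unfolding points_def cosets_def
  by (intro countable_Un countable_image) (rule countableI_type)+

lemma infinite_points: "infinite points"
proof -
  have "infinite (range Inr :: point set)"
    by (simp add: finite_image_iff)
  then show ?thesis
    by (auto simp: points_def)
qed

theorem amenable_action_amalgam:
  fixes X :: "'x set"
  assumes "infinite X" "countable X"
  shows "\<exists>\<phi>. transitive_action (amalgam c) X \<phi> \<and> faithful_action (amalgam c) X \<phi> \<and>
             amenable_action (amalgam c) X \<phi>"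
proof -
  have "bij_betw (from_nat_into X \<circ> to_nat_on points) points X"
    using to_nat_on_infinite[OF countable_points infinite_points]
      bij_betw_from_nat_into[OF assms(2,1)] by (rule bij_betw_trans)
  then obtain e where e: "bij_betw e points X" ..
  have amalgam: "amalgam c = presented_group {(left_c, right_c)}"
    by (simp add: amalgam_def left_c_def right_c_def)
  show ?thesis
    unfolding amalgam
  proof (rule presented_group_amenable_action[OF e glued_act.letter_action_axioms])
    show "Inr 0 \<in> points"
      by (rule in_points)
    show "\<exists>y\<in>points. foldr glued_act w y \<noteq> y" if "reduced w" "w \<notin> normal_closure free_group
      {u \<otimes>\<^bsub>free_group\<^esub> inv\<^bsub>free_group\<^esub> v | u v. (u, v) \<in> {(left_c, right_c)}}" for w
      using glued_act_faithful[OF that(1)] that(2) unfolding N_def .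
    show "(\<lambda>n. card (glued_act a ` Inr ` {0..int n} - Inr ` {0..int n})
      / card (Inr ` {0..int n} :: point set))
      \<longlonglongrightarrow> 0" for a
      by (rule glued_act_Folner)
  qed (use reduced_c glued_act_relation glued_act_transitive in \<open>auto simp: in_points\<close>)
qed

end

theorem theorem17:
  fixes X :: "'x set" and c :: "gen word"
  assumes "infinite X" and "countable X"
    and "special c"
    and "c \<notin> generate free_group {[(Beta, True)]}"
  shows "\<exists>\<phi>. transitive_action (amalgam c) X \<phi> \<and> faithful_action (amalgam c) X \<phi> \<and>
             amenable_action (amalgam c) X \<phi>"
proof -
  obtain k where "exponent_sum Beta c = k * exponent_sum Alpha c"
    using assms(3) unfolding special_def by (metis dvdE mult.commute mult_zero_left)
  then interpret doubled_word c k
    using assms(3,4) by unfold_locales (simp_all add: special_def)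
  show ?thesis
    by (rule amenable_action_amalgam[OF assms(1,2)])
qed

end
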